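(* Let $k$ and $m$ be positive integers with $m \leq k$. Let $\mathcal M_{(>\frac m2)}$ denote the collection of all $k$-multisets of $[m]$ that contain more than $\frac m2$ distinct elements of $[m]$, and, for $m$ even, let $\mathcal M_{(\frac m2)}$ denote the collection of all $k$-multisets of $[m]$ that contain exactly $\frac m2$ distinct elements of $[m]$. If $\mathcal A$ is an intersecting collection of $k$-multisets of $[m]$, then: (1) If $m$ is odd, then $|\mathcal A| \leq \left|\mathcal M_{(>\frac m2)}\right|$, and equality holds if and only if $\mathcal A = \mathcal M_{(>\frac m2)}$. (2) If $m$ is even, then $|\mathcal A| \leq \left|\mathcal M_{(>\frac m2)}\right| + \frac12 \left|\mathcal M_{(\frac m2)}\right|$, and equality holds if and only if $\mathcal A$ consists of $\mathcal M_{(>\frac m2)}$ together with a maximal intersecting collection of $k$-multisets from $\mathcal M_{(\frac m2)}$.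
   Context: $[m] = \{1,\dots,m\}$. A multiset is a generalization of a set in which an element may appear more than once (order is irrelevant); its cardinality is the total number of elements counted with repetitions. A $k$-multiset of (or from) $[m]$ is a multiset of cardinality $k$ all of whose elements belong to $[m]$. Two multisets are intersecting if they have at least one element in common. A collection (set) of $k$-multisets is intersecting if every pair of multisets in the collection is intersecting. A maximal intersecting collection from $\mathcal M_{(\frac m2)}$ is an intersecting subcollection of $\mathcal M_{(\frac m2)}$ that is not properly contained in any other intersecting subcollection of $\mathcal M_{(\frac m2)}$. *)

theory Defs
  imports Complex_Main "HOL-Library.Multiset"
begin

definition k_multisets :: "nat \<Rightarrow> nat \<Rightarrow> nat multiset set" where
  "k_multisets k m = {M. size M = k \<and> set_mset M \<subseteq> {1..m}}"

(* The pairs X, Y include X = Y; for collections of nonempty multisets this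
   imposes no extra condition. *)
definition intersecting :: "'a multiset set \<Rightarrow> bool" where
  "intersecting \<A> \<longleftrightarrow> (\<forall>X\<in>\<A>. \<forall>Y\<in>\<A>. set_mset X \<inter> set_mset Y \<noteq> {})"

definition maximal_intersecting_from :: "'a multiset set \<Rightarrow> 'a multiset set \<Rightarrow> bool" where
  "maximal_intersecting_from \<F> \<B> \<longleftrightarrow>
     \<B> \<subseteq> \<F> \<and> intersecting \<B> \<and> \<not> (\<exists>\<C>. \<C> \<subseteq> \<F> \<and> intersecting \<C> \<and> \<B> \<subset> \<C>)"

definition M_gt_half :: "nat \<Rightarrow> nat \<Rightarrow> nat multiset set" where
  "M_gt_half k m = {M \<in> k_multisets k m. real (card (set_mset M)) > real m / 2}"

definition M_eq_half :: "nat \<Rightarrow> nat \<Rightarrow> nat multiset set" where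
  "M_eq_half k m = {M \<in> k_multisets k m. real (card (set_mset M)) = real m / 2}"

end

(* Sort the multisets of [m] by their support. There are binom(k-1, k-s) k-multisets with a given
   support of size s, and since m <= k this number is strictly larger for t than for s whenever
   s < t and s + t = m. An intersecting collection cannot meet both the class of a support S and
   the class of its complement, so it gets at most the larger of the two classes from each
   complementary pair; summing over all S counts every pair twice and gives the bound. In the
   case of equality each pair contributes exactly its larger class, or, for |S| = m/2, exactly
   one of two classes of the same size. *)

theory Submission
  imports Defs
begin

section \<open>Multisets with a given support\<close>

definition support_class :: "'a multiset set \<Rightarrow> 'a set \<Rightarrow> 'a multiset set" where
  "support_class \<A> S = {M \<in> \<A>. set_mset M = S}"

text \<open>Taking away one copy of each element of \<open>S\<close> leaves an arbitrary multiset
  over \<open>S\<close> of size \<open>k - card S\<close>, which reduces the count to stars and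
  bars.\<close>

lemma size_set_mset_eq_image:
  assumes "finite S" and "card S \<le> k"
  shows "{M. size M = k \<and> set_mset M = S} =
    (\<lambda>M. M + mset_set S) ` multisets_of_size S (k - card S)"
proof (intro equalityI subsetI)
  fix M assume "M \<in> {M. size M = k \<and> set_mset M = S}"
  hence M: "size M = k" "set_mset M = S" by auto
  have sub: "mset_set S \<subseteq># M"
    using M(2) mset_set_set_mset_msubset[of M] by simp
  have "M - mset_set S \<in> multisets_of_size S (k - card S)"
    using M sub assms(1) in_diffD[of _ M "mset_set S"]
    by (auto simp: multisets_of_size_def size_Diff_submset)
  moreover have "M = (M - mset_set S) + mset_set S" using sub by simp
  ultimately show "M \<in> (\<lambda>M. M + mset_set S) ` multisets_of_size S (k - card S)" by blast
next
  fix M assume "M \<in> (\<lambda>M. M + mset_set S) ` multisets_of_size S (k - card S)"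
  thus "M \<in> {M. size M = k \<and> set_mset M = S}"
    using assms by (auto simp: multisets_of_size_def)
qed

lemma card_size_set_mset_eq:
  assumes "finite S" and "card S \<le> k"
  shows "card {M. size M = k \<and> set_mset M = S} = (k - 1) choose (k - card S)"
proof -
  have "card {M. size M = k \<and> set_mset M = S} = card (multisets_of_size S (k - card S))"
    unfolding size_set_mset_eq_image[OF assms] by (rule card_image) (auto simp: inj_on_def)
  thus ?thesis using assms by (simp add: card_multisets_of_size)
qed

text \<open>After reflection the lower indices are \<open>s - 1\<close> and \<open>t - 1\<close>.
  Since their sum is less than \<open>k - 1\<close>, the index \<open>s - 1\<close> lies farther
  from the middle of row \<open>k - 1\<close>.\<close>

lemma binomial_complement_less:
  fixes s t k :: nat
  assumes "s < t" and "s + t \<le> k"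
  shows "(k - 1) choose (k - s) < (k - 1) choose (k - t)"
proof (cases "s = 0")
  case True
  \<comment> \<open>Truncated subtraction rules out the reflection to \<open>s - 1\<close> here.
    Instead, the left side vanishes because its lower index \<open>k\<close> exceeds
    \<open>k - 1\<close>, and the right side is positive.\<close>
  have "k - t \<le> k - 1" "k - 1 < k - s" using assms True by auto
  thus ?thesis by (simp only: binomial_eq_0 zero_less_binomial)
next
  case False
  have sym: "(k - 1) choose (k - r) = (k - 1) choose (r - 1)" if "0 < r" "r \<le> k" for r
    using that binomial_symmetric[of "r - 1" "k - 1"] by simp
  have "(k - 1) choose (s - 1) < (k - 1) choose (t - 1)"
  proof (cases "2 * (t - 1) \<le> k - 1")
    case True
    thus ?thesis using False assms by (intro binomial_strict_mono) auto
  next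
    case far: False
    \<comment> \<open>Now \<open>t - 1\<close> is past the middle, so its mirror image
      \<open>k - t\<close> is used; \<open>s - 1 < k - t\<close> follows from
      \<open>s + t \<le> k\<close>.\<close>
    have "(k - 1) choose (s - 1) < (k - 1) choose (k - t)"
      using False far assms by (intro binomial_strict_mono) auto
    thus ?thesis using sym[of t] assms by simp
  qed
  thus ?thesis using sym[of s] sym[of t] False assms by simp
qed

lemma card_support_class_k_multisets:
  assumes "S \<subseteq> {1..m}" and "m \<le> k"
  shows "card (support_class (k_multisets k m) S) = (k - 1) choose (k - card S)"
proof -
  have "support_class (k_multisets k m) S = {M. size M = k \<and> set_mset M = S}"
    using assms(1) by (auto simp: support_class_def k_multisets_def)
  moreover have "card S \<le> k"
    using card_mono[OF _ assms(1)] assms(2) by simp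
  ultimately show ?thesis
    using card_size_set_mset_eq[of S k] finite_subset[OF assms(1)] by simp
qed

lemma finite_k_multisets: "finite (k_multisets k m)"
proof -
  have "k_multisets k m = multisets_of_size {1..m} k"
    by (auto simp: k_multisets_def multisets_of_size_def)
  thus ?thesis by auto
qed

lemma card_complement:
  assumes "S \<subseteq> {1..m}"
  shows "card ({1..m} - S) = m - card S" and "card S \<le> m"
  using assms card_mono[OF _ assms] by (auto simp: card_Diff_subset finite_subset)

text \<open>Complementation is an involution on \<open>Pow V\<close>. Summing over all
  \<open>S\<close> thus replaces the choice of a representative from each complementary
  pair.\<close>

lemma sum_Pow_complement:
  fixes f :: "'a set \<Rightarrow> 'b::comm_monoid_add"
  shows "(\<Sum>S\<in>Pow V. f (V - S)) = (\<Sum>S\<in>Pow V. f S)"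
  by (rule sum.reindex_bij_witness[of _ "\<lambda>S. V - S" "\<lambda>S. V - S"]) (auto simp: double_diff)

lemma card_eq_sum_support_class:
  assumes "\<A> \<subseteq> k_multisets k m"
  shows "card \<A> = (\<Sum>S\<in>Pow {1..m}. card (support_class \<A> S))"
proof -
  have fin: "finite \<A>" using assms finite_k_multisets finite_subset by blast
  have "set_mset ` \<A> \<subseteq> Pow {1..m}" using assms by (auto simp: k_multisets_def)
  from sum.group[OF fin _ this, of "\<lambda>_. 1::nat"] show ?thesis
    by (simp add: support_class_def)
qed

section \<open>Complementary supports\<close>

lemma M_gt_half_iff: "M \<in> M_gt_half k m \<longleftrightarrow> M \<in> k_multisets k m \<and> m < 2 * card (set_mset M)"
  unfolding M_gt_half_def by auto

lemma M_eq_half_iff: "M \<in> M_eq_half k m \<longleftrightarrow> M \<in> k_multisets k m \<and> 2 * card (set_mset M) = m"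
  unfolding M_eq_half_def by auto

text \<open>A tie \<open>2 * card S = m\<close> is resolved in favour of \<open>S\<close>; for
  \<open>m \<le> k\<close> the two classes then have equal size.\<close>

definition larger_class :: "nat \<Rightarrow> nat \<Rightarrow> nat set \<Rightarrow> nat" where
  "larger_class k m S = card (support_class (k_multisets k m)
     (if m \<le> 2 * card S then S else {1..m} - S))"

text \<open>A support larger than \<open>m / 2\<close> contributes its class at itself and again at
  its complement, whereas a support of size \<open>m / 2\<close> contributes its class only at
  itself.\<close>

lemma sum_larger_class:
  "(\<Sum>S\<in>Pow {1..m}. larger_class k m S) = 2 * card (M_gt_half k m) + card (M_eq_half k m)"
proof -
  let ?V = "{1..m}"
  let ?g = "\<lambda>S. card (support_class (M_gt_half k m) S)"
  let ?e = "\<lambda>S. card (support_class (M_eq_half k m) S)"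
  have sub: "M_gt_half k m \<subseteq> k_multisets k m" "M_eq_half k m \<subseteq> k_multisets k m"
    by (auto simp: M_gt_half_iff M_eq_half_iff)
  have "support_class (M_gt_half k m) S =
      (if m < 2 * card S then support_class (k_multisets k m) S else {})" for S
    by (auto simp: support_class_def M_gt_half_iff)
  hence g: "?g S = (if m < 2 * card S then card (support_class (k_multisets k m) S) else 0)" for S
    by simp
  have "support_class (M_eq_half k m) S =
      (if 2 * card S = m then support_class (k_multisets k m) S else {})" for S
    by (auto simp: support_class_def M_eq_half_iff)
  hence e: "?e S = (if 2 * card S = m then card (support_class (k_multisets k m) S) else 0)" for S
    by simp
  \<comment> \<open>Exactly one of \<open>m < 2 * card S\<close>, \<open>2 * card S < m\<close> and
    \<open>2 * card S = m\<close> holds, so at most one of the three terms is nonzero.\<close>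
  have "larger_class k m S = ?g S + ?g (?V - S) + ?e S" if "S \<in> Pow ?V" for S
    using card_complement[of S m] that unfolding larger_class_def g e by auto
  hence "(\<Sum>S\<in>Pow ?V. larger_class k m S) =
      (\<Sum>S\<in>Pow ?V. ?g S) + (\<Sum>S\<in>Pow ?V. ?g (?V - S)) + (\<Sum>S\<in>Pow ?V. ?e S)"
    by (simp add: sum.distrib)
  thus ?thesis
    using sum_Pow_complement[of ?g ?V] sub by (simp add: card_eq_sum_support_class)
qed

lemma sum_complementary_classes:
  assumes "\<A> \<subseteq> k_multisets k m"
  shows "(\<Sum>S\<in>Pow {1..m}. card (support_class \<A> S) + card (support_class \<A> ({1..m} - S)))
    = 2 * card \<A>"
  using sum_Pow_complement[of "\<lambda>S. card (support_class \<A> S)" "{1..m}"]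
  by (simp add: sum.distrib card_eq_sum_support_class[OF assms])

text \<open>The binomial comparison applies with \<open>s = card S\<close> and
  \<open>t = m - card S\<close>, where \<open>s + t = m \<le> k\<close>. At
  \<open>2 * card S = m\<close> both supports have the same size, hence classes of the same
  size.\<close>

lemma card_support_class_complement_le:
  assumes "m \<le> k" and "S \<subseteq> {1..m}" and "2 * card S \<le> m"
  shows "card (support_class (k_multisets k m) S) \<le> card (support_class (k_multisets k m) ({1..m} - S))"
    and "2 * card S < m \<Longrightarrow>
      card (support_class (k_multisets k m) S) < card (support_class (k_multisets k m) ({1..m} - S))"
proof -
  let ?F = "\<lambda>S. card (support_class (k_multisets k m) S)"
  have F: "?F S = (k - 1) choose (k - card S)"
    "?F ({1..m} - S) = (k - 1) choose (k - (m - card S))"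
    using assms card_complement[of S m]
    by (simp_all add: card_support_class_k_multisets)
  show less: "?F S < ?F ({1..m} - S)" if "2 * card S < m"
    unfolding F using that assms by (intro binomial_complement_less) auto
  show "?F S \<le> ?F ({1..m} - S)"
  proof (cases "2 * card S = m")
    case True
    hence "m - card S = card S" by simp
    thus ?thesis unfolding F by simp
  next
    case False
    thus ?thesis using less assms(3) by simp
  qed
qed

lemma card_support_class_le_larger_class:
  assumes "m \<le> k" and "S \<subseteq> {1..m}"
  shows "card (support_class (k_multisets k m) S) \<le> larger_class k m S"
    and "card (support_class (k_multisets k m) ({1..m} - S)) \<le> larger_class k m S"
proof -
  have *: "{1..m} - ({1..m} - S) = S" using assms(2) by blast
  show "card (support_class (k_multisets k m) S) \<le> larger_class k m S"
    using card_support_class_complement_le(1)[OF assms] by (simp add: larger_class_def)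
  show "card (support_class (k_multisets k m) ({1..m} - S)) \<le> larger_class k m S"
    using card_support_class_complement_le(1)[OF assms(1), of "{1..m} - S"] card_complement[OF assms(2)]
    unfolding * by (auto simp: larger_class_def)
qed

section \<open>Intersecting collections\<close>

lemma intersecting_support_class:
  assumes "intersecting \<A>"
  shows "support_class \<A> S = {} \<or> support_class \<A> (V - S) = {}"
  using assms unfolding intersecting_def support_class_def by blast

lemma card_support_class_mono:
  assumes "\<A> \<subseteq> k_multisets k m"
  shows "card (support_class \<A> S) \<le> card (support_class (k_multisets k m) S)"
  using assms
  by (intro card_mono finite_subset[OF _ finite_k_multisets]) (auto simp: support_class_def)

lemma complementary_classes_le:
  assumes "m \<le> k" and "\<A> \<subseteq> k_multisets k m" and "intersecting \<A>" and "S \<subseteq> {1..m}"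
  shows "card (support_class \<A> S) + card (support_class \<A> ({1..m} - S)) \<le> larger_class k m S"
  using intersecting_support_class[OF assms(3), of S "{1..m}"]
    card_support_class_mono[OF assms(2), of S] card_support_class_mono[OF assms(2), of "{1..m} - S"]
    card_support_class_le_larger_class[OF assms(1,4)]
  by auto

text \<open>The bounds for complementary pairs are summed over all supports. Doubling keeps the
  bound in the natural numbers and treats both parities of \<open>m\<close> at once.\<close>

lemma card_intersecting_le:
  assumes "m \<le> k" and "\<A> \<subseteq> k_multisets k m" and "intersecting \<A>"
  shows "2 * card \<A> \<le> 2 * card (M_gt_half k m) + card (M_eq_half k m)"
  unfolding sum_larger_class[symmetric] sum_complementary_classes[OF assms(2), symmetric]
  using complementary_classes_le[OF assms] by (intro sum_mono) auto

section \<open>The case of equality\<close>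

lemma intersecting_M_gt_half_Un:
  assumes "\<C> \<subseteq> M_eq_half k m" and "intersecting \<C>"
  shows "intersecting (M_gt_half k m \<union> \<C>)"
proof -
  \<comment> \<open>Supports in \<open>{1..m}\<close> whose sizes add up to more than
    \<open>m\<close> cannot be disjoint. This settles every pair except two members of
    \<open>\<C>\<close>.\<close>
  have meet: "set_mset X \<inter> set_mset Y \<noteq> {}"
    if "X \<in> k_multisets k m" "Y \<in> k_multisets k m"
      "m < card (set_mset X) + card (set_mset Y)" for X Y :: "nat multiset"
  proof
    assume "set_mset X \<inter> set_mset Y = {}"
    hence "card (set_mset X) + card (set_mset Y) = card (set_mset X \<union> set_mset Y)"
      by (simp add: card_Un_disjoint)
    also have "\<dots> \<le> card {1..m}"
      using that by (intro card_mono) (auto simp: k_multisets_def)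
    finally show False using that by simp
  qed
  have C: "Z \<in> k_multisets k m \<and> 2 * card (set_mset Z) = m" if "Z \<in> \<C>" for Z
    using that assms(1) M_eq_half_iff by blast
  show ?thesis
    unfolding intersecting_def
  proof (intro ballI)
    fix X Y assume XY: "X \<in> M_gt_half k m \<union> \<C>" "Y \<in> M_gt_half k m \<union> \<C>"
    show "set_mset X \<inter> set_mset Y \<noteq> {}"
    proof (cases "X \<in> \<C> \<and> Y \<in> \<C>")
      case True
      thus ?thesis using assms(2) by (auto simp: intersecting_def)
    next
      case False
      thus ?thesis
        using XY C[of X] C[of Y] by (intro meet) (auto simp: M_gt_half_iff)
    qed
  qed
qed

lemma extremal_imp_maximal:
  assumes "m \<le> k" and "\<A> \<subseteq> k_multisets k m" and "intersecting \<A>"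
    and eq: "2 * card \<A> = 2 * card (M_gt_half k m) + card (M_eq_half k m)"
  shows "\<exists>\<B>. maximal_intersecting_from (M_eq_half k m) \<B> \<and> \<A> = M_gt_half k m \<union> \<B>"
proof -
  let ?V = "{1..m}"
  \<comment> \<open>Termwise inequalities whose two sides have equal sums are equalities.\<close>
  have pair: "card (support_class \<A> S) + card (support_class \<A> (?V - S)) = larger_class k m S"
    if "S \<in> Pow ?V" for S
  proof (rule sum_mono_inv[OF _ _ that])
    show "(\<Sum>S\<in>Pow ?V. card (support_class \<A> S) + card (support_class \<A> (?V - S)))
        = (\<Sum>S\<in>Pow ?V. larger_class k m S)"
      by (simp only: sum_larger_class sum_complementary_classes[OF assms(2)] eq)
  qed (use complementary_classes_le[OF assms(1-3)] in auto)
  have full: "support_class \<A> S = support_class (k_multisets k m) S \<and> support_class \<A> (?V - S) = {}"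
    if S: "S \<subseteq> ?V" "m < 2 * card S" for S
  proof -
    have inv: "?V - (?V - S) = S" using S(1) by blast
    have sub: "support_class \<A> S \<subseteq> support_class (k_multisets k m) S"
      using assms(2) by (auto simp: support_class_def)
    have fin: "finite (support_class (k_multisets k m) S)"
      using finite_k_multisets[of k m] by (simp add: support_class_def)
    \<comment> \<open>The class of the smaller support cannot reach \<open>larger_class\<close> by
      itself, so \<open>\<A>\<close> has a member with support \<open>S\<close>; the intersection
      property then empties the complementary class.\<close>
    have "card (support_class (k_multisets k m) (?V - S)) < larger_class k m S"
      using card_support_class_complement_le(2)[OF assms(1), of "?V - S"] card_complement[OF S(1)] S
      unfolding inv by (auto simp: larger_class_def)
    hence "card (support_class \<A> (?V - S)) < larger_class k m S"
      using card_support_class_mono[OF assms(2), of "?V - S"] by simp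
    hence ne: "support_class \<A> S \<noteq> {}" using pair[of S] S(1) by auto
    hence empty: "support_class \<A> (?V - S) = {}"
      using intersecting_support_class[OF assms(3)] by blast
    have "card (support_class \<A> S) = card (support_class (k_multisets k m) S)"
      using pair[of S] S empty by (simp add: larger_class_def)
    thus ?thesis using card_subset_eq[OF fin sub] empty by blast
  qed
  have gt: "M_gt_half k m \<subseteq> \<A>"
  proof
    fix M assume "M \<in> M_gt_half k m"
    hence M: "M \<in> k_multisets k m" "m < 2 * card (set_mset M)" by (auto simp: M_gt_half_iff)
    have "M \<in> support_class (k_multisets k m) (set_mset M)"
      using M(1) by (simp add: support_class_def)
    thus "M \<in> \<A>"
      using full[of "set_mset M"] M by (auto simp: support_class_def k_multisets_def)
  qed
  \<comment> \<open>A support below half size is the complement of one above half size, and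
    \<open>full\<close> leaves its class in \<open>\<A>\<close> empty.\<close>
  have ge: "m \<le> 2 * card (set_mset M)" if "M \<in> \<A>" for M
  proof (rule ccontr)
    assume small: "\<not> m \<le> 2 * card (set_mset M)"
    have sub: "set_mset M \<subseteq> ?V" using that assms(2) by (auto simp: k_multisets_def)
    hence "?V - (?V - set_mset M) = set_mset M" by blast
    hence "support_class \<A> (set_mset M) = {}"
      using full[of "?V - set_mset M"] small card_complement[OF sub] by auto
    thus False using that by (auto simp: support_class_def)
  qed
  let ?B = "\<A> \<inter> M_eq_half k m"
  have A: "\<A> = M_gt_half k m \<union> ?B"
  proof (intro equalityI subsetI)
    fix M assume M: "M \<in> \<A>"
    hence "M \<in> k_multisets k m" using assms(2) by blast
    thus "M \<in> M_gt_half k m \<union> ?B"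
      using M ge[OF M] by (auto simp: M_gt_half_iff M_eq_half_iff)
  qed (use gt in blast)
  have "maximal_intersecting_from (M_eq_half k m) ?B"
    unfolding maximal_intersecting_from_def
  proof (intro conjI notI)
    show "?B \<subseteq> M_eq_half k m" by blast
    show "intersecting ?B" using assms(3) by (auto simp: intersecting_def)
    assume "\<exists>\<C>. \<C> \<subseteq> M_eq_half k m \<and> intersecting \<C> \<and> ?B \<subset> \<C>"
    \<comment> \<open>A proper extension \<open>\<C>\<close> would yield an intersecting collection
      larger than \<open>\<A>\<close>, although \<open>\<A>\<close> already attains the upper
      bound.\<close>
    then obtain \<C> where C: "\<C> \<subseteq> M_eq_half k m" "intersecting \<C>" "?B \<subset> \<C>" by blast
    let ?A = "M_gt_half k m \<union> \<C>"
    have sub: "?A \<subseteq> k_multisets k m"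
      using C(1) by (auto simp: M_gt_half_iff M_eq_half_iff)
    have "\<A> \<subset> ?A" using A C(1,3) by blast
    hence "card \<A> < card ?A"
      using finite_subset[OF sub finite_k_multisets] by (rule psubset_card_mono[rotated])
    moreover have "2 * card ?A \<le> 2 * card \<A>"
      unfolding eq using card_intersecting_le[OF assms(1) sub] intersecting_M_gt_half_Un[OF C(1,2)] .
    ultimately show False by simp
  qed
  thus ?thesis using A by blast
qed

text \<open>The only half-size support disjoint from \<open>S\<close> is its complement. If
  \<open>\<B>\<close> avoids that, any \<open>X\<close> with support \<open>S\<close> can be added
  to \<open>\<B>\<close>, so maximality puts it there already.\<close>

lemma maximal_support_class:
  assumes "1 \<le> m" and max: "maximal_intersecting_from (M_eq_half k m) \<B>"
    and S: "S \<subseteq> {1..m}" "2 * card S = m" and none: "support_class \<B> ({1..m} - S) = {}"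
  shows "support_class (k_multisets k m) S \<subseteq> \<B>"
proof
  fix X assume "X \<in> support_class (k_multisets k m) S"
  hence X: "X \<in> k_multisets k m" "set_mset X = S" by (auto simp: support_class_def)
  have B: "\<B> \<subseteq> M_eq_half k m" "intersecting \<B>"
    using max by (auto simp: maximal_intersecting_from_def)
  \<comment> \<open>\<open>intersecting\<close> also tests the pair of \<open>X\<close> with itself,
    so \<open>S\<close> has to be nonempty.\<close>
  have "S \<noteq> {}" using assms(1) S(2) by auto
  have meet: "S \<inter> set_mset Y \<noteq> {}" if Y: "Y \<in> \<B>" for Y
  proof
    assume disj: "S \<inter> set_mset Y = {}"
    have Y': "set_mset Y \<subseteq> {1..m}" "2 * card (set_mset Y) = m"
      using Y B(1) M_eq_half_iff[of Y k m] by (auto simp: k_multisets_def)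
    have "set_mset Y = {1..m} - S"
      using Y' disj S card_complement[OF S(1)] by (intro card_subset_eq) auto
    thus False using none Y by (auto simp: support_class_def)
  qed
  have "intersecting (insert X \<B>)"
    using meet B(2) X(2) \<open>S \<noteq> {}\<close> unfolding intersecting_def by (auto simp: Int_commute)
  moreover have "insert X \<B> \<subseteq> M_eq_half k m"
    using B(1) X S(2) by (auto simp: M_eq_half_iff)
  ultimately show "X \<in> \<B>"
    using max unfolding maximal_intersecting_from_def by blast
qed

text \<open>The general bound gives one direction. For the other, the union contains every class
  above half size and, by maximality of \<open>\<B>\<close>, a whole class from each complementary
  pair of half-size supports.\<close>

lemma maximal_imp_extremal:
  assumes "1 \<le> m" and "m \<le> k" and max: "maximal_intersecting_from (M_eq_half k m) \<B>"
  shows "2 * card (M_gt_half k m \<union> \<B>) = 2 * card (M_gt_half k m) + card (M_eq_half k m)"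
proof (rule antisym)
  let ?A = "M_gt_half k m \<union> \<B>" and ?V = "{1..m}"
  have B: "\<B> \<subseteq> M_eq_half k m" "intersecting \<B>"
    using max by (auto simp: maximal_intersecting_from_def)
  have sub: "?A \<subseteq> k_multisets k m"
    using B(1) by (auto simp: M_gt_half_iff M_eq_half_iff)
  show "2 * card ?A \<le> 2 * card (M_gt_half k m) + card (M_eq_half k m)"
    using card_intersecting_le[OF assms(2) sub] intersecting_M_gt_half_Un[OF B] .
  let ?K = "k_multisets k m"
  have full: "card (support_class ?K S) \<le> card (support_class ?A S)"
    if "support_class ?K S \<subseteq> ?A" for S
    using that finite_subset[OF sub finite_k_multisets]
    by (intro card_mono) (auto simp: support_class_def)
  have gt: "support_class ?K S \<subseteq> ?A" if "m < 2 * card S" for S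
    using that by (auto simp: support_class_def M_gt_half_iff)
  have "larger_class k m S \<le> card (support_class ?A S) + card (support_class ?A (?V - S))"
    if S: "S \<in> Pow ?V" for S
  proof -
    have S': "S \<subseteq> ?V" and c: "card (?V - S) = m - card S" "card S \<le> m"
      using S card_complement[of S m] by auto
    have inv: "?V - (?V - S) = S" using S' by blast
    consider "m < 2 * card S" | "2 * card S < m" | "2 * card S = m" by linarith
    thus ?thesis
    proof cases
      case 1
      thus ?thesis using full[OF gt[OF 1]] by (simp add: larger_class_def)
    next
      case 2
      hence "m < 2 * card (?V - S)" using c by linarith
      from full[OF gt[OF this]] 2 show ?thesis by (simp add: larger_class_def)
    next
      case 3
      show ?thesis
      proof (cases "support_class \<B> (?V - S) = {}")
        case True
        hence "support_class ?K S \<subseteq> ?A"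
          using maximal_support_class[OF assms(1) max S' 3] by blast
        thus ?thesis using full 3 by (simp add: larger_class_def trans_le_add1)
      next
        case False
        hence "support_class \<B> S = {}" using intersecting_support_class[OF B(2)] by blast
        moreover have c': "2 * card (?V - S) = m" using c 3 by linarith
        ultimately have "support_class ?K (?V - S) \<subseteq> ?A"
          using maximal_support_class[OF assms(1) max, of "?V - S"] unfolding inv by blast
        \<comment> \<open>Here \<open>larger_class\<close> measures the class of \<open>S\<close>,
          but the union contains that of \<open>?V - S\<close>, which is at least as large.\<close>
        from full[OF this] show ?thesis
          using card_support_class_complement_le(1)[OF assms(2) S'] 3
          by (simp add: larger_class_def)
      qed
    qed
  qed
  thus "2 * card (M_gt_half k m) + card (M_eq_half k m) \<le> 2 * card ?A"
    unfolding sum_larger_class[symmetric] sum_complementary_classes[OF sub, symmetric]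
    by (rule sum_mono)
qed

theorem theorem1p3:
  fixes k m :: nat and \<A> :: "nat multiset set"
  assumes "1 \<le> k" and "1 \<le> m" and "m \<le> k"
    and "\<A> \<subseteq> k_multisets k m" and "intersecting \<A>"
  shows "(odd m \<longrightarrow>
            card \<A> \<le> card (M_gt_half k m) \<and>
            (card \<A> = card (M_gt_half k m) \<longleftrightarrow> \<A> = M_gt_half k m)) \<and>
         (even m \<longrightarrow>
            real (card \<A>) \<le> real (card (M_gt_half k m)) + 1 / 2 * real (card (M_eq_half k m)) \<and>
            (real (card \<A>) = real (card (M_gt_half k m)) + 1 / 2 * real (card (M_eq_half k m)) \<longleftrightarrow>
              (\<exists>\<B>. maximal_intersecting_from (M_eq_half k m) \<B> \<and> \<A> = M_gt_half k m \<union> \<B>)))"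
proof -
  have le: "2 * card \<A> \<le> 2 * card (M_gt_half k m) + card (M_eq_half k m)"
    using assms by (intro card_intersecting_le)
  have iff: "2 * card \<A> = 2 * card (M_gt_half k m) + card (M_eq_half k m) \<longleftrightarrow>
      (\<exists>\<B>. maximal_intersecting_from (M_eq_half k m) \<B> \<and> \<A> = M_gt_half k m \<union> \<B>)"
    using extremal_imp_maximal[OF assms(3-5)] maximal_imp_extremal[OF assms(2,3)] by blast
  show ?thesis
  proof (intro conjI impI)
    assume "odd m"
    hence empty: "M_eq_half k m = {}" by (auto simp: M_eq_half_iff)
    show "card \<A> \<le> card (M_gt_half k m)" using le empty by simp
    \<comment> \<open>The only maximal intersecting collection from the empty set is empty, so
      \<open>iff\<close> reduces to the odd case.\<close>
    show "card \<A> = card (M_gt_half k m) \<longleftrightarrow> \<A> = M_gt_half k m"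
      using iff unfolding empty maximal_intersecting_from_def by auto
  next
    show "real (card \<A>) \<le> real (card (M_gt_half k m)) + 1 / 2 * real (card (M_eq_half k m))"
      using le by linarith
    have "real (card \<A>) = real (card (M_gt_half k m)) + 1 / 2 * real (card (M_eq_half k m)) \<longleftrightarrow>
        2 * card \<A> = 2 * card (M_gt_half k m) + card (M_eq_half k m)"
      by linarith
    thus "real (card \<A>) = real (card (M_gt_half k m)) + 1 / 2 * real (card (M_eq_half k m)) \<longleftrightarrow>
        (\<exists>\<B>. maximal_intersecting_from (M_eq_half k m) \<B> \<and> \<A> = M_gt_half k m \<union> \<B>)"
      using iff by simp
  qed
qed

end
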